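(* For a set $X$ of reals, the following are equivalent: (1) $X$ satisfies $\binom{\Omega}{\mathrm{T}^*}$; (2) for each continuous image $Y$ of $X$ in $[\mathbb{N}]^\infty$, if $Y$ is centered, then $Y$ is linearly refinable.
   Context: All spaces $X$ are infinite (zero-dimensional) sets of reals; all covers are assumed not to contain $X$ as a member. A cover is an $\omega$-cover of $X$ if every finite subset lies in some member; large if each point lies in infinitely many members. $[\mathbb{N}]^\infty$ is the space of infinite subsets of $\mathbb{N}$; $a\subseteq^*b$ means $a\setminus b$ finite. $Y\subseteq[\mathbb{N}]^\infty$ is centered if every nonempty finite subfamily has infinite intersection. $Y\subseteq[\mathbb{N}]^\infty$ is linearly refinable if for each $y\in Y$ there is an infinite $\hat y\subseteq y$ such that $\{\hat y:y\in Y\}$ is linearly quasiordered by $\subseteq^*$. For a countable cover enumerated bijectively as $\mathcal{U}=\{U_n:n\in\mathbb{N}\}$, let $h_\mathcal{U}:X\to P(\mathbb{N})$, $h_\mathcal{U}(x)=\{n:x\in U_n\}$. A cover $\mathcal{U}$ is a $\tau^*$-cover of $X$ if it is large and $h_\mathcal{U}[X]$ is linearly refinable. $\Omega$ and $\mathrm{T}^*$ are the collections of countable open $\omega$-covers and countable open $\tau^*$-covers of $X$; $X$ satisfies $\binom{\Omega}{\mathrm{T}^*}$ if every member of $\Omega$ has a subcollection belonging to $\mathrm{T}^*$. *)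

theory Defs
  imports "HOL-Analysis.Analysis"
begin

definition almost_subset :: "nat set \<Rightarrow> nat set \<Rightarrow> bool" (infix \<open>\<subseteq>*\<close> 50)
  where "a \<subseteq>* b \<longleftrightarrow> finite (a - b)"

definition linearly_quasiordered :: "('a \<Rightarrow> 'a \<Rightarrow> bool) \<Rightarrow> 'a set \<Rightarrow> bool"
  where "linearly_quasiordered R A \<longleftrightarrow> reflp_on A R \<and> transp_on A R \<and> totalp_on A R"

text \<open>The space of infinite subsets of the naturals: subsets are identified with their
  characteristic functions in the Cantor space, and the infinite ones carry the subspace topology.\<close>

definition Pow_nat_topology :: "nat set topology"
  where "Pow_nat_topology =
    pullback_topology UNIV (\<lambda>a n. n \<in> a)
      (product_topology (\<lambda>n::nat. discrete_topology (UNIV :: bool set)) UNIV)"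

definition infinite_sets_topology :: "nat set topology"
  where "infinite_sets_topology = subtopology Pow_nat_topology {a. infinite a}"

definition centered :: "nat set set \<Rightarrow> bool"
  where "centered Y \<longleftrightarrow> (\<forall>F. F \<subseteq> Y \<and> finite F \<and> F \<noteq> {} \<longrightarrow> infinite (\<Inter>F))"

text \<open>The function \<open>r\<close> picks the refinement of each \<open>y\<close>; its existence forces every member
  of \<open>Y\<close> to be infinite.\<close>

definition linearly_refinable :: "nat set set \<Rightarrow> bool"
  where "linearly_refinable Y \<longleftrightarrow>
    (\<exists>r. (\<forall>y\<in>Y. infinite (r y) \<and> r y \<subseteq> y) \<and> linearly_quasiordered (\<subseteq>*) (r ` Y))"

text \<open>Covers of the space \<open>X\<close> consist of subsets of \<open>X\<close> and never contain \<open>X\<close> itself.\<close>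

definition cover_of :: "'a set \<Rightarrow> 'a set set \<Rightarrow> bool"
  where "cover_of X \<U> \<longleftrightarrow> \<Union>\<U> = X \<and> X \<notin> \<U>"

definition open_cover_of :: "'a::topological_space set \<Rightarrow> 'a set set \<Rightarrow> bool"
  where "open_cover_of X \<U> \<longleftrightarrow> cover_of X \<U> \<and> (\<forall>U\<in>\<U>. openin (top_of_set X) U)"

definition omega_cover :: "'a set \<Rightarrow> 'a set set \<Rightarrow> bool"
  where "omega_cover X \<U> \<longleftrightarrow>
    cover_of X \<U> \<and> (\<forall>F. F \<subseteq> X \<and> finite F \<longrightarrow> (\<exists>U\<in>\<U>. F \<subseteq> U))"

definition large_cover :: "'a set \<Rightarrow> 'a set set \<Rightarrow> bool"
  where "large_cover X \<U> \<longleftrightarrow> cover_of X \<U> \<and> (\<forall>x\<in>X. infinite {U \<in> \<U>. x \<in> U})"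

definition trace_map :: "(nat \<Rightarrow> 'a set) \<Rightarrow> 'a \<Rightarrow> nat set"
  where "trace_map e x = {n. x \<in> e n}"

text \<open>The choice of the bijective enumeration \<open>e\<close> is immaterial; see
  \<open>tau_star_cover_iff_enumeration\<close> below.\<close>

definition tau_star_cover :: "'a set \<Rightarrow> 'a set set \<Rightarrow> bool"
  where "tau_star_cover X \<U> \<longleftrightarrow>
    large_cover X \<U> \<and>
    (\<exists>e. bij_betw e (UNIV :: nat set) \<U> \<and> linearly_refinable (trace_map e ` X))"

definition Omega_covers :: "'a::topological_space set \<Rightarrow> 'a set set set"
  where "Omega_covers X = {\<U>. countable \<U> \<and> open_cover_of X \<U> \<and> omega_cover X \<U>}"

definition Tau_star_covers :: "'a::topological_space set \<Rightarrow> 'a set set set"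
  where "Tau_star_covers X = {\<U>. countable \<U> \<and> open_cover_of X \<U> \<and> tau_star_cover X \<U>}"

text \<open>The property binomial(A, B).\<close>

definition satisfies_binom :: "'a set set \<Rightarrow> 'a set set \<Rightarrow> bool"
  where "satisfies_binom A B \<longleftrightarrow> (\<forall>\<U>\<in>A. \<exists>\<V>\<subseteq>\<U>. \<V> \<in> B)"

lemma almost_subset_quasiorder:
  "reflp_on A (\<subseteq>*)" "transp_on A (\<subseteq>*)"
proof -
  show "reflp_on A (\<subseteq>*)"
    by (simp add: reflp_on_def almost_subset_def)
  have "a \<subseteq>* c" if "a \<subseteq>* b" "b \<subseteq>* c" for a b c
  proof -
    have "a - c \<subseteq> (a - b) \<union> (b - c)" by blast
    with that show ?thesis
      unfolding almost_subset_def by (meson finite_UnI finite_subset)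
  qed
  then show "transp_on A (\<subseteq>*)"
    unfolding transp_on_def by blast
qed

lemma linearly_refinable_bij_image:
  assumes p: "bij (p :: nat \<Rightarrow> nat)" and Y: "linearly_refinable Y"
  shows "linearly_refinable ((`) p ` Y)"
proof -
  obtain r where r: "\<forall>y\<in>Y. infinite (r y) \<and> r y \<subseteq> y"
    and lin: "linearly_quasiordered (\<subseteq>*) (r ` Y)"
    using Y unfolding linearly_refinable_def by blast
  have inj: "inj p" using p by (simp add: bij_def)
  define r' where "r' z = p ` r (p -` z)" for z
  have r': "r' (p ` y) = p ` r y" for y
    by (simp add: r'_def inj_vimage_image_eq inj)
  have mono: "p ` a \<subseteq>* p ` b" if "a \<subseteq>* b" for a b
    using that unfolding almost_subset_def by (metis finite_imageI image_set_diff inj)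
  have tot: "\<And>a b. a \<in> r ` Y \<Longrightarrow> b \<in> r ` Y \<Longrightarrow> a \<subseteq>* b \<or> b \<subseteq>* a"
    using lin unfolding linearly_quasiordered_def totalp_on_def reflp_on_def by metis
  have "linearly_quasiordered (\<subseteq>*) (r' ` (`) p ` Y)"
    unfolding linearly_quasiordered_def
  proof (intro conjI almost_subset_quasiorder)
    show "totalp_on (r' ` (`) p ` Y) (\<subseteq>*)"
      unfolding totalp_on_def image_image r' using mono tot by blast
  qed
  moreover have "\<forall>z\<in>(`) p ` Y. infinite (r' z) \<and> r' z \<subseteq> z"
    using r inj by (auto simp: r' finite_image_iff inj_on_subset)
  ultimately show ?thesis
    unfolding linearly_refinable_def by blast
qed

lemma linearly_refinable_trace_map_cong:
  assumes e: "bij_betw e (UNIV :: nat set) \<U>" and e': "bij_betw e' (UNIV :: nat set) \<U>"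
    and lr: "linearly_refinable (trace_map e ` X)"
  shows "linearly_refinable (trace_map e' ` X)"
proof -
  define p where "p = inv_into UNIV e' \<circ> e"
  have p: "bij p"
    unfolding p_def using bij_betw_trans[OF e bij_betw_inv_into[OF e']] by simp
  have e'p: "e' (p n) = e n" for n
    using e e' unfolding p_def by (simp add: bij_betwE bij_betw_inv_into_right)
  have "trace_map e' x = p ` trace_map e x" for x
  proof (intro set_eqI iffI)
    fix m assume m: "m \<in> trace_map e' x"
    obtain n where "m = p n" using p by (meson bij_pointE)
    with m show "m \<in> p ` trace_map e x" by (auto simp: trace_map_def e'p)
  qed (auto simp: trace_map_def e'p)
  then have "trace_map e' ` X = (`) p ` trace_map e ` X" by (simp add: image_image)
  with linearly_refinable_bij_image[OF p lr] show ?thesis by simp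
qed

lemma tau_star_cover_iff_enumeration:
  assumes "bij_betw e (UNIV :: nat set) \<U>"
  shows "tau_star_cover X \<U> \<longleftrightarrow> large_cover X \<U> \<and> linearly_refinable (trace_map e ` X)"
  unfolding tau_star_cover_def using assms linearly_refinable_trace_map_cong by blast

end

theory Submission
  imports Defs
begin

text \<open>
  A clopen family \<open>U n\<close> is the same as a continuous map \<open>x \<mapsto> {n. x \<in> U n}\<close>, so for clopen
  covers both conditions speak about the same sets, except that (2) allows \<open>U n = X\<close> and
  repetitions. If \<open>U n = X\<close> for infinitely many \<open>n\<close>, these \<open>n\<close> form a common refinement; otherwise
  the members \<open>\<noteq> X\<close> still form an \<open>\<omega>\<close>-cover.

  For an arbitrary open \<open>\<omega>\<close>-cover, write each \<open>U n\<close> as an increasing union of clopen sets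
  \<open>C n k\<close> and refine the family \<open>C\<close> linearly. The projection of such a refinement to the first
  index remains infinite: otherwise, since by linearity any finitely many of the refining sets have
  infinite intersection, finitely many of the sets \<open>U n\<close> would already form an \<open>\<omega>\<close>-cover,
  which is impossible because each of them misses a point. Hence the cover itself is a
  \<open>\<tau>\<^sup>*\<close>-cover.
\<close>

section \<open>Almost inclusion, linear refinements and centered images\<close>

lemma almost_subset_image: "a \<subseteq>* b \<Longrightarrow> p ` a \<subseteq>* p ` b"
  unfolding almost_subset_def
  by (meson finite_imageI finite_subset image_diff_subset)

lemma linearly_quasiordered_almost_subset_iff:
  "linearly_quasiordered (\<subseteq>*) A \<longleftrightarrow> (\<forall>a\<in>A. \<forall>b\<in>A. a \<subseteq>* b \<or> b \<subseteq>* a)"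
  unfolding linearly_quasiordered_def
  using almost_subset_quasiorder[of A] by (metis reflp_on_def totalp_on_def)

text \<open>Lets the refining sets be indexed by points of \<open>X\<close> instead of values of
  \<open>g\<close>. Points with the same value may carry different sets \<open>s x\<close>, so one
  preimage of each value is fixed and its set is used.\<close>

lemma linearly_refinable_image_iff:
  "linearly_refinable (g ` X) \<longleftrightarrow>
    (\<exists>s. (\<forall>x\<in>X. infinite (s x) \<and> s x \<subseteq> g x) \<and> (\<forall>x\<in>X. \<forall>y\<in>X. s x \<subseteq>* s y \<or> s y \<subseteq>* s x))"
    (is "?L \<longleftrightarrow> (\<exists>s. ?R s)")
proof
  assume ?L
  then obtain r where "\<forall>y\<in>g ` X. infinite (r y) \<and> r y \<subseteq> y"
    and "linearly_quasiordered (\<subseteq>*) (r ` g ` X)"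
    unfolding linearly_refinable_def by blast
  then have "?R (\<lambda>x. r (g x))"
    by (auto simp: linearly_quasiordered_almost_subset_iff)
  then show "\<exists>s. ?R s" by (rule exI[of _ "\<lambda>x. r (g x)"])
next
  assume "\<exists>s. ?R s"
  then obtain s where s: "?R s" by (elim exE)
  define c where "c = inv_into X g"
  have c: "c (g x) \<in> X" "g (c (g x)) = g x" if "x \<in> X" for x
    using that by (auto simp: c_def inv_into_into f_inv_into_f)
  have "\<forall>y\<in>g ` X. infinite (s (c y)) \<and> s (c y) \<subseteq> y"
  proof
    fix y assume "y \<in> g ` X"
    then obtain x where x: "x \<in> X" "y = g x" by (elim imageE)
    with s c(1) have "infinite (s (c y))" "s (c y) \<subseteq> g (c y)" by simp_all
    then show "infinite (s (c y)) \<and> s (c y) \<subseteq> y" using c(2) x by simp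
  qed
  moreover have "linearly_quasiordered (\<subseteq>*) ((\<lambda>y. s (c y)) ` g ` X)"
    using s c by (simp add: linearly_quasiordered_almost_subset_iff)
  ultimately show ?L
    unfolding linearly_refinable_def by (intro exI[of _ "\<lambda>y. s (c y)"] conjI)
qed

text \<open>A finite nonempty chain under almost inclusion has a least member \<open>s m\<close>,
  and \<open>s m\<close> exceeds the intersection only by the finite union of the finite differences
  \<open>s m - s x\<close>.\<close>

lemma infinite_INT_of_almost_chain:
  fixes s :: "'a \<Rightarrow> nat set"
  assumes "finite F" "F \<noteq> {}" "\<And>x. x \<in> F \<Longrightarrow> infinite (s x)"
    and "\<And>x y. x \<in> F \<Longrightarrow> y \<in> F \<Longrightarrow> s x \<subseteq>* s y \<or> s y \<subseteq>* s x"
  shows "infinite (\<Inter>x\<in>F. s x)"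
proof -
  have "\<exists>m\<in>F. \<forall>x\<in>F. s m \<subseteq>* s x"
    using assms(1,2,4)
  proof (induction rule: finite_ne_induct)
    case (singleton x)
    then show ?case by (simp add: almost_subset_def)
  next
    case (insert z F)
    then obtain m where m: "m \<in> F" "\<forall>x\<in>F. s m \<subseteq>* s x" by auto
    have refl: "s z \<subseteq>* s z" by (simp add: almost_subset_def)
    consider "s m \<subseteq>* s z" | "s z \<subseteq>* s m" using insert.prems m by blast
    then show ?case
    proof cases
      case 2
      have "s z \<subseteq>* s x" if "x \<in> F" for x
        using 2 m(2) that almost_subset_quasiorder(2)[of UNIV] by (auto simp: transp_on_def)
      then show ?thesis using refl by blast
    qed (use m in blast)
  qed
  then obtain m where m: "m \<in> F" "\<forall>x\<in>F. s m \<subseteq>* s x" by blast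
  have "s m \<subseteq> (\<Inter>x\<in>F. s x) \<union> (\<Union>x\<in>F. s m - s x)" by blast
  moreover have "finite (\<Union>x\<in>F. s m - s x)"
    using m assms(1) unfolding almost_subset_def by (intro finite_UN_I) auto
  ultimately show ?thesis
    using assms(3)[OF m(1)] by (meson finite_UnI finite_subset)
qed

lemma centered_image_iff:
  "centered (f ` X) \<longleftrightarrow> (\<forall>F. F \<subseteq> X \<and> finite F \<and> F \<noteq> {} \<longrightarrow> infinite (\<Inter>x\<in>F. f x))"
proof
  assume "centered (f ` X)"
  then show "\<forall>F. F \<subseteq> X \<and> finite F \<and> F \<noteq> {} \<longrightarrow> infinite (\<Inter>x\<in>F. f x)"
    unfolding centered_def by (simp add: image_mono)
next
  assume R: "\<forall>F. F \<subseteq> X \<and> finite F \<and> F \<noteq> {} \<longrightarrow> infinite (\<Inter>x\<in>F. f x)"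
  show "centered (f ` X)"
    unfolding centered_def
  proof (intro allI impI)
    fix G assume G: "G \<subseteq> f ` X \<and> finite G \<and> G \<noteq> {}"
    then obtain F where "F \<subseteq> X" "finite F" "G = f ` F"
      using finite_subset_image by metis
    with R G show "infinite (\<Inter>G)" by auto
  qed
qed

section \<open>Continuous maps into sets of naturals as sequences of clopen sets\<close>

lemma continuous_map_discrete_bool_iff:
  "continuous_map T (discrete_topology (UNIV :: bool set)) P \<longleftrightarrow>
    openin T {x \<in> topspace T. P x} \<and> closedin T {x \<in> topspace T. P x}"
    (is "?L \<longleftrightarrow> ?R")
proof
  assume ?L
  then have "openin T {x \<in> topspace T. P x \<in> {True}}" "closedin T {x \<in> topspace T. P x \<in> {True}}"
    by (rule openin_continuous_map_preimage closedin_continuous_map_preimage; simp)+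
  then show ?R by simp
next
  assume R: ?R
  have "openin T {x \<in> topspace T. P x \<in> B}" for B
  proof -
    have *: "{x \<in> topspace T. \<not> P x} = topspace T - {x \<in> topspace T. P x}" by blast
    have neg: "openin T {x \<in> topspace T. \<not> P x}"
      unfolding * using R by blast
    have eq: "{x \<in> topspace T. P x \<in> B} =
      (if True \<in> B then {x \<in> topspace T. P x} else {}) \<union>
      (if False \<in> B then {x \<in> topspace T. \<not> P x} else {})"
      by (cases "True \<in> B"; cases "False \<in> B") (auto, (metis (full_types))+)
    show ?thesis unfolding eq using R neg by auto
  qed
  then show ?L by (simp add: continuous_map_def)
qed

text \<open>Continuity into the Cantor space is checked coordinatewise, and a coordinate is a map
  into the two-point discrete space.\<close>

lemma continuous_map_Pow_nat_iff:
  "continuous_map T Pow_nat_topology f \<longleftrightarrow>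
    (\<forall>n. openin T {x \<in> topspace T. n \<in> f x} \<and> closedin T {x \<in> topspace T. n \<in> f x})"
proof -
  let ?P = "product_topology (\<lambda>n::nat. discrete_topology (UNIV :: bool set)) UNIV"
  let ?\<chi> = "\<lambda>(a::nat set) n. n \<in> a"
  have "continuous_map T Pow_nat_topology f \<longleftrightarrow> continuous_map T ?P (?\<chi> \<circ> f)"
  proof
    have "continuous_map Pow_nat_topology ?P (id \<circ> ?\<chi>)"
      unfolding Pow_nat_topology_def by (intro continuous_map_pullback continuous_map_id)
    then show "continuous_map T Pow_nat_topology f \<Longrightarrow> continuous_map T ?P (?\<chi> \<circ> f)"
      by (metis continuous_map_compose id_comp)
  qed (auto simp: Pow_nat_topology_def intro: continuous_map_pullback')
  then show ?thesis
    by (simp add: continuous_map_componentwise_UNIV continuous_map_discrete_bool_iff)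
qed

lemma continuous_map_infinite_sets_iff:
  "continuous_map T infinite_sets_topology f \<longleftrightarrow>
    (\<forall>x\<in>topspace T. infinite (f x)) \<and>
    (\<forall>n. openin T {x \<in> topspace T. n \<in> f x} \<and> closedin T {x \<in> topspace T. n \<in> f x})"
  unfolding infinite_sets_topology_def continuous_map_in_subtopology continuous_map_Pow_nat_iff
  by auto

text \<open>The clopen sets form a base, the Lindelof property leaves countably many of those inside
  \<open>U\<close>, and finite unions of these are clopen and increase to \<open>U\<close>.\<close>

lemma zero_dim_open_increasing_clopen:
  fixes X :: "'a::second_countable_topology set"
  assumes X: "top_of_set X dim_le 0" and U: "openin (top_of_set X) U"
  obtains C :: "nat \<Rightarrow> 'a set"
  where "\<And>k. openin (top_of_set X) (C k)" "\<And>k. closedin (top_of_set X) (C k)"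
    and "incseq C" "(\<Union>k. C k) = U"
proof -
  define \<F> where "\<F> = {V. closedin (top_of_set X) V \<and> openin (top_of_set X) V \<and> V \<subseteq> U}"
  have "\<exists>V\<in>\<F>. x \<in> V" if "x \<in> U" for x
    using X U that
    unfolding dimension_le_0_neighbourhood_base_of_clopen neighbourhood_base_of \<F>_def by blast
  then have UF: "\<Union>\<F> = U" unfolding \<F>_def by blast
  obtain \<G> where G: "\<G> \<subseteq> \<F>" "countable \<G>" "\<Union>\<G> = U"
    using Lindelof_openin[of \<F> X] UF unfolding \<F>_def by auto
  have emp: "{} \<in> \<F>" by (simp add: \<F>_def)
  \<comment> \<open>Inserting the empty set makes the enumerated family nonempty even when
    \<open>U\<close> is empty.\<close>
  define g where "g = from_nat_into (insert {} \<G>)"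
  have g: "range g = insert {} \<G>"
    unfolding g_def using G(2) by (intro range_from_nat_into) auto
  have gF: "g i \<in> \<F>" for i
  proof -
    have "g i \<in> insert {} \<G>" unfolding g[symmetric] by (rule rangeI)
    then show ?thesis using G(1) emp by auto
  qed
  show thesis
  proof
    show "openin (top_of_set X) (\<Union>i\<le>k. g i)" for k
      using gF unfolding \<F>_def by (intro openin_Union) auto
    show "closedin (top_of_set X) (\<Union>i\<le>k. g i)" for k
      using gF unfolding \<F>_def by (intro closedin_Union) auto
    show "incseq (\<lambda>k. \<Union>i\<le>k. g i)"
      by (intro monoI UN_mono) auto
    have "(\<Union>k. \<Union>i\<le>k. g i) = \<Union>(range g)" by blast
    then show "(\<Union>k. \<Union>i\<le>k. g i) = U" using g G(3) by simp
  qed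
qed

section \<open>Infinitely many members in \<omega>-covers\<close>

text \<open>Since \<open>X\<close> itself is not a member, every member misses a point; one missed
  point for each member of \<open>\<V>\<close> gives \<open>F\<close>.\<close>

lemma omega_cover_no_finite_subfamily:
  assumes "omega_cover X \<U>" "\<V> \<subseteq> \<U>" "finite \<V>"
  obtains F where "F \<subseteq> X" "finite F" "\<And>V. V \<in> \<V> \<Longrightarrow> \<not> F \<subseteq> V"
proof -
  have "\<exists>x\<in>X. x \<notin> V" if "V \<in> \<V>" for V
  proof -
    have "V \<in> \<U>" "\<Union>\<U> = X" "X \<notin> \<U>"
      using assms(1,2) that by (auto simp: omega_cover_def cover_of_def)
    then have "V \<subseteq> X" "V \<noteq> X" by auto
    then show ?thesis by auto
  qed
  then obtain p where p: "\<And>V. V \<in> \<V> \<Longrightarrow> p V \<in> X \<and> p V \<notin> V" by metis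
  show thesis
    by (rule that[of "p ` \<V>"]) (use p assms(3) in auto)
qed

text \<open>If only finitely many members contained \<open>F\<close>, some finite \<open>G\<close>
  would lie in none of them, and then no member could contain \<open>F \<union> G\<close>.\<close>

lemma omega_cover_infinitely_often:
  assumes U: "omega_cover X \<U>" and F: "F \<subseteq> X" "finite F"
  shows "infinite {U \<in> \<U>. F \<subseteq> U}"
proof
  assume "finite {U \<in> \<U>. F \<subseteq> U}"
  then obtain G where G: "G \<subseteq> X" "finite G" "\<And>V. V \<in> {U \<in> \<U>. F \<subseteq> U} \<Longrightarrow> \<not> G \<subseteq> V"
    using omega_cover_no_finite_subfamily[OF U] by (metis (lifting) mem_Collect_eq subsetI)
  obtain U where "U \<in> \<U>" "F \<union> G \<subseteq> U"
    using U F G(1,2) unfolding omega_cover_def by (meson Un_least finite_UnI)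
  with G(3) show False by blast
qed

text \<open>Used with \<open>p\<close> the projection of a pair index to the index of the cover
  member: it says that refining sets stay infinite under this projection.\<close>

lemma omega_cover_infinite_index_image:
  fixes s :: "'a \<Rightarrow> nat set" and U :: "nat \<Rightarrow> 'a set"
  assumes U: "omega_cover X (range U)"
    and s: "\<And>x. x \<in> X \<Longrightarrow> infinite (s x)" "\<And>x i. x \<in> X \<Longrightarrow> i \<in> s x \<Longrightarrow> x \<in> U (p i)"
    and lin: "\<And>x y. x \<in> X \<Longrightarrow> y \<in> X \<Longrightarrow> s x \<subseteq>* s y \<or> s y \<subseteq>* s x"
    and x: "x \<in> X"
  shows "infinite (p ` s x)"
proof
  assume "finite (p ` s x)"
  then obtain F where F: "F \<subseteq> X" "finite F" "\<And>n. n \<in> p ` s x \<Longrightarrow> \<not> F \<subseteq> U n"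
    using omega_cover_no_finite_subfamily[OF U, of "U ` p ` s x"]
    by (metis finite_imageI image_eqI image_mono subset_UNIV)
  have "infinite (\<Inter>y\<in>insert x F. s y)"
  proof (rule infinite_INT_of_almost_chain)
    have "insert x F \<subseteq> X" using F(1) x by simp
    then show "infinite (s y)" "s y \<subseteq>* s z \<or> s z \<subseteq>* s y"
      if "y \<in> insert x F" "z \<in> insert x F" for y z
      using that s(1) lin by (meson subsetD)+
  qed (use F(2) in simp_all)
  then obtain i where i: "i \<in> (\<Inter>y\<in>insert x F. s y)"
    by (metis all_not_in_conv finite.emptyI)
  then have "F \<subseteq> U (p i)" using F(1) s(2) by blast
  with F(3) i show False by blast
qed

section \<open>The two implications\<close>

text \<open>Condition (2) is applied to the trace map of the clopen approximations of the members,
  and the refinement found there is projected back to the cover.\<close>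

lemma omega_cover_is_tau_star_cover:
  fixes X :: "'a::second_countable_topology set"
  assumes dim: "top_of_set X dim_le 0"
    and ref: "\<And>f. continuous_map (top_of_set X) infinite_sets_topology f \<Longrightarrow>
      centered (f ` X) \<Longrightarrow> linearly_refinable (f ` X)"
    and U: "\<U> \<in> Omega_covers X"
  shows "\<U> \<in> Tau_star_covers X"
proof -
  have cnt: "countable \<U>" and opn: "open_cover_of X \<U>" and om: "omega_cover X \<U>"
    using U by (auto simp: Omega_covers_def)
  have "infinite \<U>"
    using omega_cover_infinitely_often[OF om, of "{}"] by simp
  then obtain e :: "nat \<Rightarrow> 'a set" where e: "bij_betw e UNIV \<U>"
    using bij_betw_from_nat_into cnt by blast
  have ran: "range e = \<U>" using e by (simp add: bij_betw_def)
  have inf_n: "infinite {n. F \<subseteq> e n}" if "F \<subseteq> X" "finite F" for F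
  proof -
    have "{V \<in> \<U>. F \<subseteq> V} = e ` {n. F \<subseteq> e n}" using ran by blast
    with omega_cover_infinitely_often[OF om that] show ?thesis by (metis finite_imageI)
  qed
  have "openin (top_of_set X) (e n)" for n
    using opn ran unfolding open_cover_of_def by blast
  then have "\<exists>C :: nat \<Rightarrow> 'a set. (\<forall>k. openin (top_of_set X) (C k) \<and> closedin (top_of_set X) (C k)) \<and>
      incseq C \<and> (\<Union>k. C k) = e n" for n
    by (metis zero_dim_open_increasing_clopen[OF dim])
  then obtain C :: "nat \<Rightarrow> nat \<Rightarrow> 'a set" where
    C: "\<And>n k. openin (top_of_set X) (C n k)" "\<And>n k. closedin (top_of_set X) (C n k)"
      "\<And>n. incseq (C n)" "\<And>n. (\<Union>k. C n k) = e n"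
    by metis
  \<comment> \<open>\<open>D\<close> lists the double sequence \<open>C\<close> along the pairing
    function, and \<open>p i\<close> recovers the member \<open>e (p i)\<close> that
    \<open>D i\<close> approximates.\<close>
  define p where "p i = fst (prod_decode i)" for i
  define D where "D i = case_prod C (prod_decode i)" for i
  have D_sub: "D i \<subseteq> e (p i)" for i
    using C(4) by (auto simp: D_def p_def split: prod.splits)
  have D_clopen: "openin (top_of_set X) (D i)" "closedin (top_of_set X) (D i)" for i
    using C(1,2) by (auto simp: D_def split: prod.splits)
  have inf_D: "infinite {i. F \<subseteq> D i}" if F: "F \<subseteq> X" "finite F" for F
  proof -
    obtain n where n: "F \<subseteq> e n" using inf_n[OF F] by (metis Collect_empty_eq finite.emptyI)
    have "\<forall>x\<in>F. \<exists>k. x \<in> C n k" using n C(4) by blast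
    then obtain k where k: "\<And>x. x \<in> F \<Longrightarrow> x \<in> C n (k x)" by metis
    \<comment> \<open>The inserted \<open>0\<close> keeps \<open>Max\<close> meaningful for empty
      \<open>F\<close>. Because \<open>C n\<close> increases, a single \<open>n\<close> already
      supplies infinitely many indices, namely those of all pairs \<open>(n, j)\<close> with
      \<open>K \<le> j\<close>.\<close>
    define K where "K = Max (insert 0 (k ` F))"
    have "k x \<le> K" if "x \<in> F" for x
      using that F(2) by (simp add: K_def)
    then have Cj: "x \<in> C n j" if "j \<ge> K" "x \<in> F" for j x
      using k C(3) that by (meson incseq_def order_trans subset_iff)
    have "(\<lambda>j. prod_encode (n, j)) ` {K..} \<subseteq> {i. F \<subseteq> D i}"
      using Cj by (auto simp: D_def)
    moreover have "infinite ((\<lambda>j. prod_encode (n, j)) ` {K..})"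
      by (subst finite_image_iff) (auto simp: inj_on_def infinite_Ici)
    ultimately show ?thesis using finite_subset by blast
  qed
  have "continuous_map (top_of_set X) infinite_sets_topology (trace_map D)"
    unfolding continuous_map_infinite_sets_iff
  proof (intro conjI ballI allI)
    show "infinite (trace_map D x)" if "x \<in> topspace (top_of_set X)" for x
      using inf_D[of "{x}"] that by (simp add: trace_map_def)
    have "{x \<in> topspace (top_of_set X). n \<in> trace_map D x} = D n" for n
      using openin_subset[OF D_clopen(1)[of n]] by (auto simp: trace_map_def)
    then show "openin (top_of_set X) {x \<in> topspace (top_of_set X). n \<in> trace_map D x}"
      "closedin (top_of_set X) {x \<in> topspace (top_of_set X). n \<in> trace_map D x}" for n
      using D_clopen by simp_all
  qed
  moreover have "centered (trace_map D ` X)"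
    unfolding centered_image_iff
  proof (intro allI impI)
    fix F assume F: "F \<subseteq> X \<and> finite F \<and> F \<noteq> {}"
    have "(\<Inter>x\<in>F. trace_map D x) = {i. F \<subseteq> D i}" by (auto simp: trace_map_def)
    with inf_D F show "infinite (\<Inter>x\<in>F. trace_map D x)" by simp
  qed
  ultimately obtain s where
    s: "\<forall>x\<in>X. infinite (s x) \<and> s x \<subseteq> trace_map D x"
    and lin: "\<forall>x\<in>X. \<forall>y\<in>X. s x \<subseteq>* s y \<or> s y \<subseteq>* s x"
    using ref[of "trace_map D"] unfolding linearly_refinable_image_iff by blast
  have s_sub: "x \<in> e (p i)" if "x \<in> X" "i \<in> s x" for x i
    using s that D_sub by (auto simp: trace_map_def)
  have "infinite (p ` s x)" if "x \<in> X" for x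
    by (rule omega_cover_infinite_index_image[where U = e and X = X]) (use om ran s s_sub lin that in auto)
  moreover have "p ` s x \<subseteq> trace_map e x" if "x \<in> X" for x
    using s_sub that by (auto simp: trace_map_def)
  moreover have "p ` s x \<subseteq>* p ` s y \<or> p ` s y \<subseteq>* p ` s x" if "x \<in> X" "y \<in> X" for x y
    using lin that almost_subset_image by blast
  ultimately have "linearly_refinable (trace_map e ` X)"
    unfolding linearly_refinable_image_iff by (intro exI[of _ "\<lambda>x. p ` s x"]) blast
  moreover have "large_cover X \<U>"
    using om omega_cover_infinitely_often[OF om, of "{_}"]
    by (auto simp: large_cover_def omega_cover_def)
  ultimately show ?thesis
    using cnt opn e by (auto simp: Tau_star_covers_def tau_star_cover_iff_enumeration[OF e])
qed

text \<open>The clopen sets \<open>U n\<close> have \<open>f\<close> as their trace map on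
  \<open>X\<close>. Centeredness makes every finite subset of \<open>X\<close> lie in infinitely
  many \<open>U n\<close>, which yields an \<omega>-cover once the value \<open>X\<close> can be
  removed.\<close>

lemma centered_image_linearly_refinable:
  fixes X :: "'a::topological_space set"
  assumes binom: "satisfies_binom (Omega_covers X) (Tau_star_covers X)"
    and f: "continuous_map (top_of_set X) infinite_sets_topology f"
    and cen: "centered (f ` X)"
  shows "linearly_refinable (f ` X)"
proof -
  define U where "U n = {x \<in> X. n \<in> f x}" for n
  have opn: "openin (top_of_set X) (U n)" for n
    using f unfolding continuous_map_infinite_sets_iff U_def by simp
  have inf_n: "infinite {n. F \<subseteq> U n}" if F: "F \<subseteq> X" "finite F" for F
  proof (cases "F = {}")
    case False
    then have "infinite (\<Inter>x\<in>F. f x)" using cen F by (simp add: centered_image_iff)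
    moreover have "(\<Inter>x\<in>F. f x) = {n. F \<subseteq> U n}" using F False by (auto simp: U_def)
    ultimately show ?thesis by simp
  qed simp
  show ?thesis
  proof (cases "infinite {n. U n = X}")
    case True
    have "{n. U n = X} \<subseteq> f x" if "x \<in> X" for x
      using that by (auto simp: U_def)
    then show ?thesis
      \<comment> \<open>One infinite set lies inside every \<open>f x\<close>, so the constant
        refinement works.\<close>
      unfolding linearly_refinable_image_iff
      by (intro exI[of _ "\<lambda>x. {n. U n = X}"]) (use True in \<open>auto simp: almost_subset_def\<close>)
  next
    case False
    define \<U> where "\<U> = range U - {X}"
    have ex: "\<exists>V\<in>\<U>. F \<subseteq> V" if F: "F \<subseteq> X" "finite F" for F
    proof -
      \<comment> \<open>Dropping the finitely many indices with \<open>U n = X\<close> leaves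
        infinitely many, so a proper member still contains \<open>F\<close>.\<close>
      have "infinite ({n. F \<subseteq> U n} - {n. U n = X})"
        using inf_n[OF F] False by (simp add: Diff_infinite_finite)
      then obtain n where "F \<subseteq> U n" "U n \<noteq> X"
        by (metis (mono_tags, lifting) Diff_iff ex_in_conv finite.emptyI mem_Collect_eq)
      then show ?thesis by (auto simp: \<U>_def)
    qed
    have "\<Union>\<U> = X"
    proof
      show "\<Union>\<U> \<subseteq> X" by (auto simp: \<U>_def U_def)
      show "X \<subseteq> \<Union>\<U>" using ex[of "{_}"] by auto
    qed
    then have "\<U> \<in> Omega_covers X"
      using ex opn
      by (auto simp: Omega_covers_def open_cover_of_def omega_cover_def cover_of_def \<U>_def)
    then obtain \<V> where V: "\<V> \<subseteq> \<U>" "\<V> \<in> Tau_star_covers X"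
      using binom unfolding satisfies_binom_def by blast
    then obtain e :: "nat \<Rightarrow> 'a set" where e: "bij_betw e UNIV \<V>"
      and lr: "linearly_refinable (trace_map e ` X)"
      unfolding Tau_star_covers_def tau_star_cover_def by blast
    have "\<exists>n. U n = e m" for m
    proof -
      have "e m \<in> range U" using bij_betwE[OF e] V(1) unfolding \<U>_def by blast
      then show ?thesis by auto
    qed
    \<comment> \<open>The sequence \<open>U\<close> may repeat sets, so \<open>q\<close> picks one
      original index for each member of \<open>\<V>\<close>. It is injective because
      \<open>e\<close> is, hence it carries infinite refining sets to infinite subsets of
      \<open>f x\<close>.\<close>
    then obtain q where q: "\<And>m. U (q m) = e m" by metis
    have "inj q"
      using bij_betw_imp_inj_on[OF e] q by (metis injD injI)
    from lr obtain s where
      s: "\<forall>x\<in>X. infinite (s x) \<and> s x \<subseteq> trace_map e x"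
      and lin: "\<forall>x\<in>X. \<forall>y\<in>X. s x \<subseteq>* s y \<or> s y \<subseteq>* s x"
      unfolding linearly_refinable_image_iff by blast
    have "infinite (q ` s x)" if "x \<in> X" for x
      using s that \<open>inj q\<close> by (meson finite_imageD inj_on_subset subset_UNIV)
    moreover have "q ` s x \<subseteq> f x" if x: "x \<in> X" for x
    proof
      fix n assume "n \<in> q ` s x"
      then obtain m where "n = q m" "m \<in> s x" by (elim imageE)
      with s x have "n = q m" "x \<in> e m" by (auto simp: trace_map_def)
      then show "n \<in> f x" by (auto simp: q[symmetric] U_def)
    qed
    moreover have "q ` s x \<subseteq>* q ` s y \<or> q ` s y \<subseteq>* q ` s x" if "x \<in> X" "y \<in> X" for x y
      using lin that almost_subset_image by blast
    ultimately show ?thesis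
      unfolding linearly_refinable_image_iff by (intro exI[of _ "\<lambda>x. q ` s x"]) blast
  qed
qed

theorem theorem7p5:
  fixes X :: "real set"
  assumes "infinite X"
    and "top_of_set X dim_le 0"
  shows "satisfies_binom (Omega_covers X) (Tau_star_covers X) \<longleftrightarrow>
    (\<forall>Y. (\<exists>f. continuous_map (top_of_set X) infinite_sets_topology f \<and> Y = f ` X) \<longrightarrow>
         centered Y \<longrightarrow> linearly_refinable Y)"
proof
  assume "satisfies_binom (Omega_covers X) (Tau_star_covers X)"
  then show "\<forall>Y. (\<exists>f. continuous_map (top_of_set X) infinite_sets_topology f \<and> Y = f ` X) \<longrightarrow>
         centered Y \<longrightarrow> linearly_refinable Y"
    using centered_image_linearly_refinable by blast
next
  assume "\<forall>Y. (\<exists>f. continuous_map (top_of_set X) infinite_sets_topology f \<and> Y = f ` X) \<longrightarrow>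
         centered Y \<longrightarrow> linearly_refinable Y"
  then show "satisfies_binom (Omega_covers X) (Tau_star_covers X)"
    unfolding satisfies_binom_def
    using omega_cover_is_tau_star_cover[OF assms(2)] by blast
qed

end
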